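(* Let $G$ and $H$ be arithmetical functions on the monic polynomials of $A=\mathbb{F}_q[X]$, and for monic $h,f\in A$ put $$S(h;f)=\sum_{g\mid (h,f)} G(g)\,H(f/g).$$ Consider the polynomial zeta function $\zeta_A(s)$ and the Dirichlet series $D_H(s)$ of $H$ given by $$\zeta_A(s)=\sum_{f}|f|^{-s},\qquad D_H(s)=\sum_f H(f)\,|f|^{-s},$$ the sums running over all monic $f\in A$. Suppose that $D_H(s)$ is convergent for $\Re(s)>\sigma_0$. Then: (i) for $\Re(s)>1$, $$\sum_h S(h;f)\,|h|^{-s}=\zeta_A(s)\sum_{g\mid f}G(g)\,H(f/g)\,|g|^{-s},$$ the sum on the left running over all monic $h\in A$, with $f\in A$ a fixed monic polynomial; (ii) for $\Re(s)>\sigma_0$, $$\sum_f S(h;f)\,|f|^{-s}=D_H(s)\sum_{g\mid h}G(g)\,|g|^{-s},$$ the sum on the left running over all monic $f\in A$, with $h\in A$ a fixed monic polynomial.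
   Context: $A=\mathbb{F}_q[X]$ is the polynomial ring over the finite field with $q=p^t$ elements, $p$ prime, $t$ a positive integer. An arithmetical function is a complex-valued function defined on the set of monic polynomials in $A$. For nonzero $f\in A$, $|f|=q^{\deg f}$. $(a,b)$ denotes the monic greatest common divisor of $a$ and $b$, and sums over $g\mid n$ run over the monic divisors $g$ of $n$. Here $s$ is a complex variable and $\sigma_0$ is a real number. *)

theory Defs
  imports "HOL-Analysis.Analysis" "HOL-Computational_Algebra.Computational_Algebra"
begin

text \<open>
  The coefficient field \<open>F\<^sub>q\<close> is a type \<open>'a\<close> of sort \<open>{finite_field, field_gcd}\<close>, with
  \<open>q = CARD('a)\<close>.  The class \<open>field_gcd\<close> only makes the library's \<open>gcd\<close> on \<open>'a poly\<close> available
  and excludes no field: on a field its operations are forced to be the trivial ones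
  (\<open>unit_factor x = x\<close>, \<open>normalize x = 1\<close> for \<open>x \<noteq> 0\<close>).  Hence \<open>gcd\<close> on \<open>'a poly\<close> is the monic gcd;
  see \<open>lead_coeff_gcd_poly\<close> below.

  An arithmetical function is a function on all of \<open>'a poly\<close> of which only the values at monic
  polynomials are ever used.
\<close>

definition monics :: "'a::field poly set" where
  "monics = {f. lead_coeff f = 1}"

definition poly_abs :: "'a::{finite, field} poly \<Rightarrow> real" where
  "poly_abs f = real CARD('a) ^ degree f"

definition dterm ::
    "('a::{finite, field} poly \<Rightarrow> complex) \<Rightarrow> complex \<Rightarrow> 'a poly \<Rightarrow> complex" where
  "dterm a s f = a f * complex_of_real (poly_abs f) powr (- s)"

definition Ssum :: "('a::{finite_field, field_gcd} poly \<Rightarrow> complex) \<Rightarrow> ('a poly \<Rightarrow> complex)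
    \<Rightarrow> 'a poly \<Rightarrow> 'a poly \<Rightarrow> complex" where
  "Ssum G H h f = (\<Sum>g | g \<in> monics \<and> g dvd gcd h f. G g * H (f div g))"

text \<open>
  A series over all monic polynomials can be read in two ways: as an unordered sum
  (\<open>has_sum\<close>, \<open>summable_on\<close>, \<open>infsum\<close> over \<open>monics\<close>), or as the limit of the partial sums over
  \<open>|f| \<le> x\<close>, as is usual for Dirichlet series.  As \<open>|f|\<close> depends only on the degree, the latter is
  the series over \<open>n\<close> of the finite sums over the monic polynomials of degree \<open>n\<close>.  It is weaker:
  unordered summability implies convergence by degree, with the same value.
\<close>

definition degree_part :: "('a::{finite, field} poly \<Rightarrow> complex) \<Rightarrow> nat \<Rightarrow> complex" where
  "degree_part F n = (\<Sum>f | f \<in> monics \<and> degree f = n. F f)"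

definition dirichlet :: "('a::{finite, field} poly \<Rightarrow> complex) \<Rightarrow> complex \<Rightarrow> complex" where
  "dirichlet a s = (\<Sum>\<^sub>\<infinity>f\<in>monics. dterm a s f)"

definition dirichlet_by_degree ::
    "('a::{finite, field} poly \<Rightarrow> complex) \<Rightarrow> complex \<Rightarrow> complex" where
  "dirichlet_by_degree a s = (\<Sum>n. degree_part (dterm a s) n)"

text \<open>The argument of type \<open>'a itself\<close> selects the coefficient field.\<close>

definition zeta_poly :: "'a::{finite, field} itself \<Rightarrow> complex \<Rightarrow> complex" where
  "zeta_poly _ s = (\<Sum>\<^sub>\<infinity>f\<in>(monics :: 'a poly set). complex_of_real (poly_abs f) powr (- s))"

lemma lead_coeff_gcd_poly:
  fixes h f :: "'a::field_gcd poly"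
  assumes "h \<noteq> 0 \<or> f \<noteq> 0"
  shows "lead_coeff (gcd h f) = 1"
proof -
  have ne: "gcd h f \<noteq> 0" using assms by auto
  have "unit_factor (gcd h f) = 1" using ne by (simp add: unit_factor_gcd)
  then have "unit_factor (lead_coeff (gcd h f)) = 1"
    by (simp add: unit_factor_poly_def one_pCons)
  moreover have "unit_factor (lead_coeff (gcd h f)) = lead_coeff (gcd h f)"
    using ne by (intro is_unit_unit_factor) (simp add: dvd_field_iff)
  ultimately show ?thesis by simp
qed

lemma finite_degree_le: "finite {f :: 'a::{finite, field} poly. degree f \<le> n}"
proof (rule finite_subset)
  show "{f :: 'a poly. degree f \<le> n} \<subseteq> Poly ` {xs. set xs \<subseteq> UNIV \<and> length xs \<le> Suc n}"
  proof
    fix f :: "'a poly" assume "f \<in> {f. degree f \<le> n}"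
    then have "length (coeffs f) \<le> Suc n" by (cases "f = 0") (auto simp: length_coeffs)
    then show "f \<in> Poly ` {xs. set xs \<subseteq> UNIV \<and> length xs \<le> Suc n}"
      by (intro image_eqI[of _ _ "coeffs f"]) auto
  qed
  show "finite (Poly ` {xs :: 'a list. set xs \<subseteq> UNIV \<and> length xs \<le> Suc n})"
    by (intro finite_imageI finite_lists_length_le) simp
qed

lemma finite_monics_degree: "finite {f. f \<in> (monics :: 'a::{finite, field} poly set) \<and> degree f = n}"
  by (rule finite_subset[OF _ finite_degree_le[of n]]) auto

lemma finite_monic_divisors:
  fixes f :: "'a::{finite, field} poly"
  assumes "f \<noteq> 0"
  shows "finite {g. g \<in> monics \<and> g dvd f}"
  by (rule finite_subset[OF _ finite_degree_le[of "degree f"]]) (use assms dvd_imp_degree_le in auto)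

end

theory Submission
  imports Defs
begin

text \<open>
  Each \<open>g\<close> dividing both \<open>h\<close> and \<open>f\<close> contributes \<open>G g * H (f div g)\<close> to \<open>S(h;f)\<close>.  Fix one of the
  two arguments, let \<open>g\<close> run over its finitely many monic divisors, and turn the requirement that
  \<open>g\<close> divide the other argument into an indicator.  As a function of the free argument, \<open>S\<close> is
  then a finite linear combination of functions \<open>dilate g a\<close>, which vanish off the multiples
  of \<open>g\<close> and take the value \<open>a k\<close> at \<open>g * k\<close>: with \<open>a = 1\<close> when \<open>h\<close> varies, and with \<open>a = H\<close> when
  \<open>f\<close> varies.

  Because \<open>|g * k| = |g| * |k|\<close> and \<open>k \<mapsto> g * k\<close> is a bijection from the monic polynomials
  onto the monic multiples of \<open>g\<close>, the Dirichlet series of \<open>dilate g a\<close> is \<open>|g|\<close> to the power \<open>-s\<close>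
  times that of \<open>a\<close> (\<open>has_sum_dterm_dilate\<close>).  When the series are summed by degree, the
  bijection raises the degree by \<open>deg g\<close>, so that the series is multiplied by the same
  factor and shifted by finitely many zero terms (\<open>sums_degree_part_dilate\<close>).
  All three claims follow by summing over \<open>g\<close>; no interchange of two infinite sums occurs, so
  convergence of \<open>D\<^sub>H\<close> in either sense is enough.  For the first claim one also needs
  that \<open>\<zeta>\<^sub>A(s)\<close> converges for \<open>Re s > 1\<close>: there are at most \<open>q ^ n\<close> monic
  polynomials of degree \<open>n\<close>, and this gives a geometric series (\<open>zeta_poly_has_sum\<close>).
\<close>

section \<open>Monic polynomials and their multiples\<close>

lemma monic_nonzero: "f \<in> monics \<Longrightarrow> f \<noteq> 0"
  by (auto simp: monics_def)

lemma monic_mult_iff: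
  assumes "g \<in> monics"
  shows "g * k \<in> monics \<longleftrightarrow> k \<in> monics"
  using assms by (simp add: monics_def lead_coeff_mult)

lemma degree_monic_mult:
  assumes "g \<in> monics" "k \<in> monics"
  shows "degree (g * k) = degree g + degree k"
  using assms monic_nonzero by (intro degree_mult_eq) auto

lemma inj_on_monic_mult:
  assumes "g \<in> monics"
  shows "inj_on ((*) g) A"
  using monic_nonzero[OF assms] by (auto intro: inj_onI)

text \<open>
  This is the Dirichlet convolution of \<open>a\<close> with the point mass at \<open>g\<close>, so its Dirichlet series
  is the product of the two.
\<close>

definition dilate :: "'a::field poly \<Rightarrow> ('a poly \<Rightarrow> complex) \<Rightarrow> 'a poly \<Rightarrow> complex" where
  "dilate g a f = (if g dvd f then a (f div g) else 0)"

lemma dterm_dilate_mult: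
  fixes a :: "'a::{finite, field} poly \<Rightarrow> complex"
  assumes "g \<in> monics" "k \<in> monics"
  shows "dterm (dilate g a) s (g * k) = complex_of_real (poly_abs g) powr (- s) * dterm a s k"
proof -
  have "complex_of_real (poly_abs (g * k)) powr (- s)
      = complex_of_real (poly_abs g) powr (- s) * complex_of_real (poly_abs k) powr (- s)"
    unfolding poly_abs_def degree_monic_mult[OF assms] power_add of_real_mult
    by (intro powr_times_real) auto
  then show ?thesis
    using monic_nonzero[OF assms(1)] by (simp add: dterm_def dilate_def)
qed

section \<open>Dirichlet series of dilated functions\<close>

lemma has_sum_dterm_dilate:
  fixes a :: "'a::{finite, field} poly \<Rightarrow> complex"
  assumes g: "g \<in> monics" and a: "(dterm a s has_sum A) monics"
  shows "(dterm (dilate g a) s has_sum complex_of_real (poly_abs g) powr (- s) * A) monics"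
proof -
  have "((\<lambda>k. dterm (dilate g a) s (g * k)) has_sum complex_of_real (poly_abs g) powr (- s) * A)
      monics"
    using has_sum_cmult_right[OF a, of "complex_of_real (poly_abs g) powr (- s)"]
    by (subst has_sum_cong[OF dterm_dilate_mult[OF g]]) simp_all
  then have "(dterm (dilate g a) s has_sum complex_of_real (poly_abs g) powr (- s) * A)
      ((*) g ` monics)"
    by (simp add: has_sum_reindex[OF inj_on_monic_mult[OF g]] o_def)
  also have "(dterm (dilate g a) s has_sum complex_of_real (poly_abs g) powr (- s) * A)
        ((*) g ` monics)
      \<longleftrightarrow> (dterm (dilate g a) s has_sum complex_of_real (poly_abs g) powr (- s) * A) monics"
  proof (rule has_sum_cong_neutral)
    show "dterm (dilate g a) s f = 0" if "f \<in> monics - (*) g ` monics" for f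
      using that by (auto simp: dterm_def dilate_def monic_mult_iff[OF g] elim!: dvdE)
    show "dterm (dilate g a) s f = 0" if "f \<in> (*) g ` monics - monics" for f
      using that by (auto simp: monic_mult_iff[OF g])
  qed simp
  finally show ?thesis .
qed

text \<open>
  The monic multiples of \<open>g\<close> of degree \<open>n + deg g\<close> correspond to the monic polynomials of
  degree \<open>n\<close>, so convergence by degree is preserved even when the unordered sums do not exist.
\<close>

lemma degree_part_dterm_dilate:
  fixes a :: "'a::{finite, field} poly \<Rightarrow> complex"
  assumes g: "g \<in> monics"
  shows "degree_part (dterm (dilate g a) s) (n + degree g)
    = complex_of_real (poly_abs g) powr (- s) * degree_part (dterm a s) n"
proof -
  let ?K = "{k. k \<in> monics \<and> degree k = n}"
  have "degree_part (dterm (dilate g a) s) (n + degree g)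
      = sum (dterm (dilate g a) s) ((*) g ` ?K)"
    unfolding degree_part_def
  proof (rule sum.mono_neutral_right)
    show "finite {f. f \<in> (monics :: 'a poly set) \<and> degree f = n + degree g}"
      by (rule finite_monics_degree)
    show "(*) g ` ?K \<subseteq> {f. f \<in> monics \<and> degree f = n + degree g}"
      using g by (auto simp: monic_mult_iff degree_monic_mult)
    show "\<forall>f\<in>{f. f \<in> monics \<and> degree f = n + degree g} - (*) g ` ?K. dterm (dilate g a) s f = 0"
      using g by (auto simp: dterm_def dilate_def monic_mult_iff degree_monic_mult elim!: dvdE)
  qed
  also have "\<dots> = (\<Sum>k\<in>?K. dterm (dilate g a) s (g * k))"
    using inj_on_monic_mult[OF g] by (simp add: sum.reindex o_def)
  also have "\<dots> = (\<Sum>k\<in>?K. complex_of_real (poly_abs g) powr (- s) * dterm a s k)"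
    by (intro sum.cong) (auto simp: dterm_dilate_mult[OF g])
  finally show ?thesis
    by (simp add: degree_part_def sum_distrib_left)
qed

lemma sums_degree_part_dilate:
  fixes a :: "'a::{finite, field} poly \<Rightarrow> complex"
  assumes g: "g \<in> monics" and a: "degree_part (dterm a s) sums A"
  shows "degree_part (dterm (dilate g a) s) sums (complex_of_real (poly_abs g) powr (- s) * A)"
proof -
  have zero: "degree_part (dterm (dilate g a) s) n = 0" if "n < degree g" for n
    unfolding degree_part_def
  proof (rule sum.neutral, safe)
    fix f :: "'a poly" assume "f \<in> monics" "n = degree f"
    then have "\<not> g dvd f"
      using that dvd_imp_degree_le[of g f] monic_nonzero by auto
    then show "dterm (dilate g a) s f = 0"
      by (simp add: dterm_def dilate_def)
  qed
  have "(\<lambda>n. degree_part (dterm (dilate g a) s) (n + degree g))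
      sums (complex_of_real (poly_abs g) powr (- s) * A)"
    unfolding degree_part_dterm_dilate[OF g] by (rule sums_mult[OF a])
  then show ?thesis
    by (subst (asm) sums_zero_iff_shift[OF zero])
qed

section \<open>Convergence of the zeta function\<close>

text \<open>
  The bound holds because a monic polynomial of degree \<open>n\<close> is determined by its \<open>n\<close> lower
  coefficients.
\<close>

lemma card_monics_degree_le:
  "card {f. f \<in> (monics :: 'a::{finite, field} poly set) \<and> degree f = n} \<le> CARD('a) ^ n"
proof -
  let ?M = "{f. f \<in> (monics :: 'a poly set) \<and> degree f = n}"
  let ?c = "\<lambda>f :: 'a poly. map (coeff f) [0..<n]"
  have "inj_on ?c ?M"
  proof (rule inj_onI)
    fix f k assume fk: "f \<in> ?M" "k \<in> ?M" "?c f = ?c k"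
    show "f = k"
    proof (rule poly_eqI)
      fix i
      consider "i < n" | "i = n" | "i > n" by linarith
      then show "coeff f i = coeff k i"
        using fk by cases (auto simp: monics_def coeff_eq_0)
    qed
  qed
  moreover have "?c ` ?M \<subseteq> {xs. set xs \<subseteq> UNIV \<and> length xs = n}"
    by auto
  ultimately have "card ?M \<le> card {xs :: 'a list. set xs \<subseteq> UNIV \<and> length xs = n}"
    by (intro card_inj_on_le finite_lists_length_eq) auto
  then show ?thesis
    using card_lists_length_eq[of "UNIV :: 'a set" n] by simp
qed

text \<open>
  Put \<open>r = q powr - Re s\<close>.  The terms of degree \<open>n\<close> have modulus \<open>r ^ n\<close> and there are at most
  \<open>q ^ n\<close> of them, so every finite sum of moduli is bounded by the geometric series of ratio
  \<open>q * r\<close>, which is less than \<open>1\<close> exactly because \<open>Re s > 1\<close>.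
\<close>

lemma zeta_poly_has_sum:
  assumes "Re s > 1"
  shows "(dterm (\<lambda>_. 1) s has_sum zeta_poly TYPE('a::{finite, field}) s) (monics :: 'a poly set)"
proof -
  let ?M = "monics :: 'a poly set"
  define q where "q = real CARD('a)"
  define r where "r = q powr (- Re s)"
  have "CARD('a) \<noteq> 1"
  proof
    assume "CARD('a) = 1"
    then obtain z :: 'a where "UNIV = {z}" by (rule card_1_singletonE)
    then have "(0 :: 'a) = 1" by (metis UNIV_I singletonD)
    then show False by simp
  qed
  moreover have "CARD('a) > 0" by simp
  ultimately have q: "q > 1"
    unfolding q_def by linarith
  then have r: "r > 0" by (simp add: r_def)
  have "q * r = q powr (1 - Re s)"
    using q by (simp add: r_def powr_diff powr_minus divide_inverse)
  also have "\<dots> < 1"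
    using q assms powr_less_mono[of "1 - Re s" 0 q] by simp
  finally have qr: "q * r < 1" "0 \<le> q * r"
    using q r by simp_all
  have norm_eq: "norm (dterm (\<lambda>_. 1) s f) = r ^ degree f" for f :: "'a poly"
  proof -
    have "norm (dterm (\<lambda>_. 1) s f) = (q ^ degree f) powr (- Re s)"
      by (simp add: dterm_def norm_powr_real_powr poly_abs_def q_def)
    also have "\<dots> = r ^ degree f"
      using q powr_realpow[OF r, of "degree f"]
      by (simp add: powr_realpow[of q, symmetric] r_def powr_powr mult.commute)
    finally show ?thesis .
  qed
  have "sum (\<lambda>f. norm (dterm (\<lambda>_. 1) s f)) F \<le> (\<Sum>n. (q * r) ^ n)"
    if F: "F \<subseteq> ?M" "finite F" for F
  proof -
    define N where "N = degree ` F"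
    have "sum (\<lambda>f. norm (dterm (\<lambda>_. 1) s f)) F = (\<Sum>n\<in>N. \<Sum>f | f \<in> F \<and> degree f = n. r ^ n)"
      using F(2) unfolding N_def norm_eq
      by (subst sum.group[symmetric, where g = degree and T = "degree ` F"]) auto
    also have "\<dots> \<le> (\<Sum>n\<in>N. (q * r) ^ n)"
    proof (rule sum_mono)
      fix n
      have "card {f. f \<in> F \<and> degree f = n} \<le> card {f. f \<in> ?M \<and> degree f = n}"
        using F by (intro card_mono finite_monics_degree) auto
      also have "\<dots> \<le> CARD('a) ^ n"
        by (rule card_monics_degree_le)
      finally have "real (card {f. f \<in> F \<and> degree f = n}) \<le> real (CARD('a) ^ n)"
        by (rule of_nat_mono)
      then have "real (card {f. f \<in> F \<and> degree f = n}) \<le> q ^ n"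
        by (simp add: q_def)
      then show "(\<Sum>f | f \<in> F \<and> degree f = n. r ^ n) \<le> (q * r) ^ n"
        using r by (simp add: power_mult_distrib mult_right_mono)
    qed
    also have "\<dots> \<le> (\<Sum>n. (q * r) ^ n)"
      using F(2) qr by (intro sum_le_suminf summable_geometric) (auto simp: N_def)
    finally show ?thesis .
  qed
  then have "(\<lambda>f. norm (dterm (\<lambda>_. 1) s f)) summable_on ?M"
    by (intro nonneg_bdd_above_summable_on bdd_aboveI2) auto
  then have "dterm (\<lambda>_. 1) s summable_on ?M"
    by (rule abs_summable_summable)
  then show ?thesis
    using has_sum_infsum[of "dterm (\<lambda>_. 1) s" ?M] by (simp add: zeta_poly_def dterm_def[abs_def])
qed

section \<open>The sum \<open>S(h;f)\<close> as a combination of dilated functions\<close>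

text \<open>
  The two expansions differ in which argument is dilated; both restrict the divisors of one
  argument to those that also divide the other.
\<close>

lemma Ssum_eq_sum_dilate_one:
  assumes "f \<in> monics"
  shows "Ssum G H h f = (\<Sum>g | g \<in> monics \<and> g dvd f. G g * H (f div g) * dilate g (\<lambda>_. 1) h)"
  unfolding Ssum_def
  using finite_monic_divisors[OF monic_nonzero[OF assms]]
  by (intro sum.mono_neutral_cong_left) (auto simp: dilate_def)

lemma Ssum_eq_sum_dilate:
  assumes "h \<in> monics"
  shows "Ssum G H h f = (\<Sum>g | g \<in> monics \<and> g dvd h. G g * dilate g H f)"
  unfolding Ssum_def
  using finite_monic_divisors[OF monic_nonzero[OF assms]]
  by (intro sum.mono_neutral_cong_left) (auto simp: dilate_def)

lemma dterm_linear:
  "dterm (\<lambda>f. \<Sum>g\<in>D. c g * b g f) s = (\<lambda>f. \<Sum>g\<in>D. c g * dterm (b g) s f)"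
  by (simp add: dterm_def fun_eq_iff sum_distrib_right mult.assoc)

lemma degree_part_linear:
  "degree_part (\<lambda>f. \<Sum>g\<in>D. c g * b g f) = (\<lambda>n. \<Sum>g\<in>D. c g * degree_part (b g) n)"
  unfolding degree_part_def fun_eq_iff sum_distrib_left by (auto intro: sum.swap)

lemma has_sum_finite_sum:
  fixes F :: "'i \<Rightarrow> 'b \<Rightarrow> 'c::topological_comm_monoid_add"
  assumes "finite D" "\<And>g. g \<in> D \<Longrightarrow> (F g has_sum A g) M"
  shows "((\<lambda>f. \<Sum>g\<in>D. F g f) has_sum (\<Sum>g\<in>D. A g)) M"
  using assms by (induction D rule: finite_induct) (auto intro: has_sum_add)

lemma has_sum_dterm_dilate_linear:
  fixes a :: "'a::{finite, field} poly \<Rightarrow> complex"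
  assumes "finite D" "D \<subseteq> monics" "(dterm a s has_sum A) monics"
  shows "(dterm (\<lambda>f. \<Sum>g\<in>D. c g * dilate g a f) s has_sum
    A * (\<Sum>g\<in>D. c g * complex_of_real (poly_abs g) powr (- s))) monics"
proof -
  have "((\<lambda>f. \<Sum>g\<in>D. c g * dterm (dilate g a) s f) has_sum
      (\<Sum>g\<in>D. c g * (complex_of_real (poly_abs g) powr (- s) * A))) monics"
    using assms by (intro has_sum_finite_sum has_sum_cmult_right has_sum_dterm_dilate) auto
  then show ?thesis
    by (simp add: dterm_linear sum_distrib_left mult_ac)
qed

lemma sums_degree_part_dilate_linear:
  fixes a :: "'a::{finite, field} poly \<Rightarrow> complex"
  assumes "D \<subseteq> monics" "degree_part (dterm a s) sums A"
  shows "degree_part (dterm (\<lambda>f. \<Sum>g\<in>D. c g * dilate g a f) s) sums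
    (A * (\<Sum>g\<in>D. c g * complex_of_real (poly_abs g) powr (- s)))"
proof -
  have "(\<lambda>n. \<Sum>g\<in>D. c g * degree_part (dterm (dilate g a) s) n) sums
      (\<Sum>g\<in>D. c g * (complex_of_real (poly_abs g) powr (- s) * A))"
    using assms by (intro sums_sum sums_mult sums_degree_part_dilate) auto
  then show ?thesis
    by (simp add: dterm_linear degree_part_linear sum_distrib_left mult_ac)
qed

section \<open>Dirichlet series of \<open>S\<close> in either argument\<close>

theorem theorem4p1:
  fixes G H :: "'a::{finite_field, field_gcd} poly \<Rightarrow> complex" and \<sigma>\<^sub>0 :: real
  shows
    "(\<comment> \<open>(i)\<close>
      \<forall>f\<in>monics. \<forall>s. Re s > 1 \<longrightarrow>
        (dterm (\<lambda>h. Ssum G H h f) s has_sum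
          zeta_poly TYPE('a) s *
            (\<Sum>g | g \<in> monics \<and> g dvd f.
               G g * H (f div g) * complex_of_real (poly_abs g) powr (- s)))
        monics)
     \<and>
     (\<comment> \<open>(ii), unordered sums\<close>
      (\<forall>s. Re s > \<sigma>\<^sub>0 \<longrightarrow> dterm H s summable_on monics) \<longrightarrow>
      (\<forall>h\<in>monics. \<forall>s. Re s > \<sigma>\<^sub>0 \<longrightarrow>
        (dterm (\<lambda>f. Ssum G H h f) s has_sum
          dirichlet H s *
            (\<Sum>g | g \<in> monics \<and> g dvd h. G g * complex_of_real (poly_abs g) powr (- s)))
        monics))
     \<and>
     (\<comment> \<open>(ii), sums ordered by degree\<close>
      (\<forall>s. Re s > \<sigma>\<^sub>0 \<longrightarrow> summable (degree_part (dterm H s))) \<longrightarrow>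
      (\<forall>h\<in>monics. \<forall>s. Re s > \<sigma>\<^sub>0 \<longrightarrow>
        degree_part (dterm (\<lambda>f. Ssum G H h f) s) sums
          (dirichlet_by_degree H s *
            (\<Sum>g | g \<in> monics \<and> g dvd h. G g * complex_of_real (poly_abs g) powr (- s)))))"
proof (intro conjI impI ballI allI)
  fix f :: "'a poly" and s :: complex
  assume f: "f \<in> monics" and s: "Re s > 1"
  show "(dterm (\<lambda>h. Ssum G H h f) s has_sum
      zeta_poly TYPE('a) s *
        (\<Sum>g | g \<in> monics \<and> g dvd f.
           G g * H (f div g) * complex_of_real (poly_abs g) powr (- s)))
    monics"
    unfolding Ssum_eq_sum_dilate_one[OF f]
    by (intro has_sum_dterm_dilate_linear finite_monic_divisors monic_nonzero[OF f]
        zeta_poly_has_sum[OF s]) auto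
next
  fix h :: "'a poly" and s :: complex
  assume "\<forall>s. Re s > \<sigma>\<^sub>0 \<longrightarrow> dterm H s summable_on monics"
    and h: "h \<in> monics" and s: "Re s > \<sigma>\<^sub>0"
  then have "(dterm H s has_sum dirichlet H s) monics"
    by (simp add: dirichlet_def)
  then show "(dterm (\<lambda>f. Ssum G H h f) s has_sum
      dirichlet H s *
        (\<Sum>g | g \<in> monics \<and> g dvd h. G g * complex_of_real (poly_abs g) powr (- s)))
    monics"
    unfolding Ssum_eq_sum_dilate[OF h]
    by (intro has_sum_dterm_dilate_linear finite_monic_divisors monic_nonzero[OF h]) auto
next
  fix h :: "'a poly" and s :: complex
  assume "\<forall>s. Re s > \<sigma>\<^sub>0 \<longrightarrow> summable (degree_part (dterm H s))"
    and h: "h \<in> monics" and s: "Re s > \<sigma>\<^sub>0"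
  then have "degree_part (dterm H s) sums dirichlet_by_degree H s"
    by (simp add: dirichlet_by_degree_def summable_sums)
  then show "degree_part (dterm (\<lambda>f. Ssum G H h f) s) sums
      (dirichlet_by_degree H s *
        (\<Sum>g | g \<in> monics \<and> g dvd h. G g * complex_of_real (poly_abs g) powr (- s)))"
    unfolding Ssum_eq_sum_dilate[OF h]
    by (intro sums_degree_part_dilate_linear) auto
qed

end
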